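(* Let $G$ be a finite graph (multiple edges allowed, no loops) with $\delta(G)\geq 1$, and let $a,b:V(G)\to\mathbb{Z}_{\geq 0}$ be two functions such that $d_G(v)\geq a(v)+b(v)+2w_G(v)-1$ for every $v\in V(G)$. Then there is a partition $(A,B)$ of $V(G)$ into two non-empty sets such that $d_{G[A]}(v)\geq a(v)$ for all $v\in A$ and $d_{G[B]}(v)\geq b(v)$ for all $v\in B$.
   Context: Graphs are finite and undirected, may have multiple edges but no loops. $d_G(v)$ is the number of edges incident with $v$ (counting multiplicities), $\delta(G)$ the minimum degree. For distinct vertices $u,v$, $\mu_G(u,v)$ is the number of edges joining $u$ and $v$, and $w_G(u)=\max_{v\in V(G)\setminus\{u\}}\mu_G(u,v)$. For $X\subseteq V(G)$, $G[X]$ is the induced subgraph (containing all edges, with multiplicity, between vertices of $X$). A partition $(A,B)$ of $V(G)$ requires $A,B$ to be disjoint, non-empty, with union $V(G)$. *)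

theory Defs imports Main begin

text \<open>Parallel edges are distinct elements of \<open>edges\<close> with the same set of ends.\<close>

record ('v, 'e) mgraph =
  verts :: "'v set"
  edges :: "'e set"
  ends  :: "'e \<Rightarrow> 'v set"

text \<open>
  The condition \<open>card (ends G e) = 2\<close> excludes loops. The null graph is excluded, as its
  minimum degree is not defined.
\<close>

locale multigraph =
  fixes G :: "('v, 'e) mgraph"
  assumes finite_verts: "finite (verts G)"
    and finite_edges: "finite (edges G)"
    and verts_nonempty: "verts G \<noteq> {}"
    and ends_subset: "\<And>e. e \<in> edges G \<Longrightarrow> ends G e \<subseteq> verts G"
    and card_ends: "\<And>e. e \<in> edges G \<Longrightarrow> card (ends G e) = 2"

definition degree :: "('v, 'e) mgraph \<Rightarrow> 'v \<Rightarrow> nat" where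
  "degree G v = card {e \<in> edges G. v \<in> ends G e}"

definition min_degree :: "('v, 'e) mgraph \<Rightarrow> nat" where
  "min_degree G = Min (degree G ` verts G)"

definition multiplicity :: "('v, 'e) mgraph \<Rightarrow> 'v \<Rightarrow> 'v \<Rightarrow> nat" where
  "multiplicity G u v = card {e \<in> edges G. ends G e = {u, v}}"

text \<open>Meaningful only if \<open>G\<close> has a vertex other than \<open>u\<close>.\<close>

definition max_multiplicity :: "('v, 'e) mgraph \<Rightarrow> 'v \<Rightarrow> nat" where
  "max_multiplicity G u = Max (multiplicity G u ` (verts G - {u}))"

definition induced_subgraph :: "('v, 'e) mgraph \<Rightarrow> 'v set \<Rightarrow> ('v, 'e) mgraph" where
  "induced_subgraph G X = \<lparr>verts = X, edges = {e \<in> edges G. ends G e \<subseteq> X}, ends = ends G\<rparr>"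

lemma (in multigraph) multigraph_induced_subgraph:
  assumes "X \<subseteq> verts G" "X \<noteq> {}"
  shows "multigraph (induced_subgraph G X)"
  using assms finite_verts finite_edges card_ends
  by unfold_locales (auto simp: induced_subgraph_def intro: finite_subset)

lemma (in multigraph) two_vertices_if_min_degree:
  assumes "min_degree G \<ge> 1"
  shows "verts G - {u} \<noteq> {}"
proof
  assume "verts G - {u} = {}"
  with verts_nonempty have V: "verts G = {u}" by blast
  have "{e \<in> edges G. u \<in> ends G e} = {}"
  proof (rule ccontr)
    assume "{e \<in> edges G. u \<in> ends G e} \<noteq> {}"
    then obtain e where e: "e \<in> edges G" by blast
    have "card (ends G e) \<le> card {u}"
      using ends_subset[OF e] V by (intro card_mono) auto
    with card_ends[OF e] show False by simp
  qed
  with assms V show False by (simp add: min_degree_def degree_def)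
qed

end

theory Submission imports Defs begin

text \<open>
  Following Stiebitz, it suffices to find two disjoint non-empty sets satisfying the degree
  conditions, since a maximal such pair covers the graph. Put \<open>s = a + w - 1\<close> and
  \<open>t = b + w - 1\<close>, and suppose that there is no such pair. A minimal non-empty set in which all
  degrees are at least \<open>a\<close> forms with its complement a partition into an \<open>s\<close>-degenerate set \<open>A\<close>
  and a \<open>t\<close>-degenerate set \<open>B\<close>. Among all such partitions take one that maximises
  \<open>e(A) + e(B) + t(A) + s(B)\<close>. As \<open>d \<ge> s + t + 1\<close>, moving a vertex \<open>v \<in> A\<close> of degree at most
  \<open>s(v)\<close> in \<open>A\<close> increases this weight, so \<open>B + v\<close> is not \<open>t\<close>-degenerate, and likewise
  \<open>A + u\<close> is not \<open>s\<close>-degenerate for some \<open>u \<in> B\<close>. Subsets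
  \<open>Y \<subseteq> B + v\<close> and \<open>X \<subseteq> A + u\<close> witnessing this have degrees at least \<open>b + w\<close> and \<open>a + w\<close>, and
  removing a vertex lowers degrees by at most \<open>w\<close>, so the disjoint sets \<open>X - v\<close> and \<open>Y - u\<close>
  satisfy the degree conditions.
\<close>

section \<open>Degrees, degenerate sets and weights for a symmetric multiplicity function\<close>

locale symmetric_weights =
  fixes V :: "'v set" and m :: "'v \<Rightarrow> 'v \<Rightarrow> nat"
  assumes finite_V: "finite V"
    and sym: "m u v = m v u"
    and diag: "m v v = 0"
begin

definition deg :: "'v set \<Rightarrow> 'v \<Rightarrow> nat" where
  "deg X v = (\<Sum>x\<in>X. m v x)"

definition good :: "('v \<Rightarrow> nat) \<Rightarrow> 'v set \<Rightarrow> bool" where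
  "good f X \<longleftrightarrow> (\<forall>x\<in>X. f x \<le> deg X x)"

definition degenerate :: "('v \<Rightarrow> nat) \<Rightarrow> 'v set \<Rightarrow> bool" where
  "degenerate f X \<longleftrightarrow> (\<forall>Y\<subseteq>X. Y \<noteq> {} \<longrightarrow> (\<exists>y\<in>Y. deg Y y \<le> f y))"

definition degenerate_partition ::
  "('v \<Rightarrow> nat) \<Rightarrow> ('v \<Rightarrow> nat) \<Rightarrow> 'v set \<Rightarrow> 'v set \<Rightarrow> bool" where
  "degenerate_partition s t A B \<longleftrightarrow>
    A \<inter> B = {} \<and> A \<union> B = V \<and> degenerate s A \<and> degenerate t B"

text \<open>Twice \<open>e(A) + e(B) + t(A) + s(B)\<close>: the sums of degrees count every edge twice.\<close>

definition weight :: "('v \<Rightarrow> nat) \<Rightarrow> ('v \<Rightarrow> nat) \<Rightarrow> 'v set \<Rightarrow> 'v set \<Rightarrow> nat" where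
  "weight s t A B =
    (\<Sum>v\<in>A. deg A v + 2 * t v) + (\<Sum>v\<in>B. deg B v + 2 * s v)"

lemma weight_swap: "weight s t A B = weight t s B A"
  by (simp add: weight_def)

lemma degenerate_partition_swap:
  "degenerate_partition s t A B \<longleftrightarrow> degenerate_partition t s B A"
  by (auto simp: degenerate_partition_def)

lemma deg_mono: "finite Y \<Longrightarrow> X \<subseteq> Y \<Longrightarrow> deg X v \<le> deg Y v"
  unfolding deg_def by (intro sum_mono2) auto

lemma deg_insert: "finite X \<Longrightarrow> v \<notin> X \<Longrightarrow> deg (insert v X) u = deg X u + m u v"
  by (simp add: deg_def)

lemma deg_Un: "finite X \<Longrightarrow> finite Y \<Longrightarrow> X \<inter> Y = {} \<Longrightarrow> deg (X \<union> Y) v = deg X v + deg Y v"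
  by (simp add: deg_def sum.union_disjoint)

text \<open>By symmetry, \<open>deg X v\<close> enters twice: as the degree of \<open>v\<close> and
  as the total increase of the degrees in \<open>X\<close>.\<close>

lemma sum_deg_insert:
  assumes "finite X" "v \<notin> X"
  shows "(\<Sum>x\<in>insert v X. deg (insert v X) x + f x) = (\<Sum>x\<in>X. deg X x + f x) + 2 * deg X v + f v"
proof -
  have "(\<Sum>x\<in>X. m x v) = deg X v"
    unfolding deg_def by (intro sum.cong refl sym)
  then show ?thesis
    using assms by (simp add: deg_insert diag sum.distrib)
qed

text \<open>Only one side is treated; swapping \<open>s\<close> with \<open>t\<close> and
  \<open>A\<close> with \<open>B\<close> gives the other.\<close>

lemma not_degenerate_insert_if_maximal:
  assumes part: "degenerate_partition s t A B"
    and max: "\<And>A' B'. degenerate_partition s t A' B' \<Longrightarrow> weight s t A' B' \<le> weight s t A B"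
    and large: "\<And>v. v \<in> V \<Longrightarrow> s v + t v < deg V v"
    and "V \<noteq> {}"
  shows "\<exists>v\<in>A. \<not> degenerate t (insert v B)"
proof -
  have disj: "A \<inter> B = {}" and un: "A \<union> B = V" and dA: "degenerate s A" and dB: "degenerate t B"
    using part by (auto simp: degenerate_partition_def)
  have fin: "finite A" "finite B" using finite_V un by auto
  \<comment> \<open>Otherwise \<open>V\<close> itself would be \<open>t\<close>-degenerate, although
    all its degrees exceed \<open>t\<close>.\<close>
  have "A \<noteq> {}"
  proof
    assume "A = {}"
    then have "degenerate t V" using dB un by simp
    then obtain v where "v \<in> V" "deg V v \<le> t v"
      using \<open>V \<noteq> {}\<close> unfolding degenerate_def by blast
    then show False using large[of v] by simp
  qed
  then obtain v where v: "v \<in> A" "deg A v \<le> s v"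
    using dA unfolding degenerate_def by blast
  define A' where "A' = A - {v}"
  have A: "A = insert v A'" "v \<notin> A'" "finite A'" and "v \<notin> B"
    using v fin disj by (auto simp: A'_def)
  have "deg A v = deg A' v" using A by (simp add: deg_insert diag)
  moreover have "deg V v = deg A v + deg B v"
    using un disj fin deg_Un by metis
  \<comment> \<open>As \<open>deg A' v\<close> is at most \<open>s v\<close>, more than
    \<open>t v\<close> remains for \<open>deg B v\<close>. Moving \<open>v\<close> changes the
    weight by twice the difference of the two sides.\<close>
  ultimately have less: "deg A' v + t v < deg B v + s v"
    using large[of v] v un by force
  have "\<not> degenerate t (insert v B)"
  proof
    assume "degenerate t (insert v B)"
    moreover have "degenerate s A'" using dA A unfolding degenerate_def by blast
    ultimately have "degenerate_partition s t A' (insert v B)"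
      using disj un A unfolding degenerate_partition_def by blast
    from max[OF this] have "weight s t A' (insert v B) \<le> weight s t (insert v A') B"
      using A by simp
    with less show False
      using sum_deg_insert[OF A(3,2), of "\<lambda>x. 2 * t x"]
        sum_deg_insert[OF fin(2) \<open>v \<notin> B\<close>, of "\<lambda>x. 2 * s x"]
      by (simp add: weight_def)
  qed
  with v show ?thesis by blast
qed

lemma good_remove:
  assumes "finite X" "\<And>x. x \<in> X \<Longrightarrow> f x + w x \<le> deg X x"
    and "\<And>x. x \<in> X \<Longrightarrow> m x v \<le> w x"
  shows "good f (X - {v})"
  unfolding good_def
proof
  fix x assume x: "x \<in> X - {v}"
  \<comment> \<open>An inequality, so that \<open>v\<close> outside \<open>X\<close> is covered as
    well.\<close>
  have "deg X x \<le> deg (X - {v}) x + m x v"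
    using deg_insert[of "X - {v}" v x] assms(1) deg_mono[of "insert v X" X x]
    by (simp add: subset_insertI)
  with assms(2,3)[of x] x show "f x \<le> deg (X - {v}) x" by simp
qed

text \<open>Without loops, the vertex of a singleton has degree 0 in it.\<close>

lemma minus_singleton_nonempty_if_deg:
  assumes "X \<noteq> {}" "\<And>x. x \<in> X \<Longrightarrow> 1 \<le> deg X x"
  shows "X - {v} \<noteq> {}"
proof
  assume "X - {v} = {}"
  with assms(1) have "X = {v}" by blast
  with assms(2)[of v] show False by (simp add: deg_def diag)
qed

end

section \<open>Feasible pairs and their extension to a partition\<close>

locale stiebitz_weights = symmetric_weights V m for V :: "'v set" and m +
  fixes w a b :: "'v \<Rightarrow> nat"
  assumes V_nonempty: "V \<noteq> {}"
    and w_pos: "v \<in> V \<Longrightarrow> 1 \<le> w v"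
    and m_le_w: "v \<in> V \<Longrightarrow> u \<in> V \<Longrightarrow> m v u \<le> w v"
    and deg_large: "v \<in> V \<Longrightarrow> a v + b v + 2 * w v \<le> deg V v + 1"
begin

definition feasible :: "'v set \<Rightarrow> 'v set \<Rightarrow> bool" where
  "feasible A B \<longleftrightarrow>
    A \<noteq> {} \<and> B \<noteq> {} \<and> A \<inter> B = {} \<and> A \<union> B \<subseteq> V \<and> good a A \<and> good b B"

text \<open>The subtraction does not truncate on \<open>V\<close>, where \<open>w\<close> is
  positive; so exceeding \<open>s\<close> means reaching \<open>a + w\<close>.\<close>

definition s :: "'v \<Rightarrow> nat" where "s v = a v + w v - 1"
definition t :: "'v \<Rightarrow> nat" where "t v = b v + w v - 1"

lemma s_t_less: "v \<in> V \<Longrightarrow> s v + t v < deg V v"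
  using deg_large[of v] w_pos[of v] by (auto simp: s_def t_def)

lemma degenerate_partition_if_not_feasible:
  assumes infeasible: "\<And>A B. \<not> feasible A B"
  shows "\<exists>A B. degenerate_partition s t A B"
proof -
  define P where "P X \<longleftrightarrow> X \<noteq> {} \<and> X \<subseteq> V \<and> good a X" for X
  have "P V"
    unfolding P_def good_def
  proof (intro conjI ballI)
    fix v assume "v \<in> V"
    then show "a v \<le> deg V v" using s_t_less[of v] w_pos[of v] by (auto simp: s_def)
  qed (use V_nonempty in auto)
  then obtain A where PA: "P A" and min: "\<And>X. P X \<Longrightarrow> card A \<le> card X"
    using ex_has_least_nat[of P V card] by blast
  have A: "A \<noteq> {}" "A \<subseteq> V" "good a A" and finA: "finite A"
    using PA finite_V finite_subset by (auto simp: P_def)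
  have not_P: "\<not> P X" if "X \<subset> A" for X
    using min[of X] psubset_card_mono[OF finA that] by auto
  \<comment> \<open>A subset violating this would, after losing one vertex, be a smaller set with
    \<open>P\<close>.\<close>
  have "degenerate s A"
    unfolding degenerate_def
  proof (intro allI impI)
    fix Y assume Y: "Y \<subseteq> A" "Y \<noteq> {}"
    then have YV: "Y \<subseteq> V" and finY: "finite Y"
      using A finA finite_subset by auto
    show "\<exists>y\<in>Y. deg Y y \<le> s y"
    proof (rule ccontr)
      assume "\<not> ?thesis"
      then have *: "a y + w y \<le> deg Y y" if "y \<in> Y" for y
        using that by (force simp: s_def)
      obtain v where v: "v \<in> Y" using Y by blast
      have "good a (Y - {v})"
        using * m_le_w v YV finY by (intro good_remove[where w = w]) auto
      moreover have "Y - {v} \<noteq> {}"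
        using Y
      proof (intro minus_singleton_nonempty_if_deg)
        fix y assume "y \<in> Y"
        with *[of y] w_pos[of y] Y A show "1 \<le> deg Y y" by force
      qed
      ultimately have "P (Y - {v})" using Y A by (auto simp: P_def)
      with not_P[of "Y - {v}"] v Y show False by blast
    qed
  qed
  \<comment> \<open>A non-empty \<open>Y\<close> that is good for \<open>b\<close> would be feasible
    with \<open>A\<close>; hence some degree in \<open>Y\<close> is below \<open>b\<close>, which is
    at most \<open>t\<close>.\<close>
  moreover have "degenerate t (V - A)"
    unfolding degenerate_def
  proof (intro allI impI)
    fix Y assume Y: "Y \<subseteq> V - A" "Y \<noteq> {}"
    with infeasible[of A Y] A have "\<not> good b Y" by (auto simp: feasible_def)
    then obtain y where "y \<in> Y" "deg Y y < b y" by (auto simp: good_def)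
    with w_pos[of y] Y show "\<exists>y\<in>Y. deg Y y \<le> t y" by (force simp: t_def)
  qed
  ultimately have "degenerate_partition s t A (V - A)"
    using A by (auto simp: degenerate_partition_def)
  then show ?thesis by blast
qed

lemma feasible_pair: "\<exists>A B. feasible A B"
proof (rule ccontr)
  assume infeasible: "\<not> ?thesis"
  define D where "D = {(A, B). degenerate_partition s t A B}"
  have "D \<subseteq> Pow V \<times> Pow V" by (auto simp: D_def degenerate_partition_def)
  then have "finite D" using finite_V finite_subset by blast
  moreover have "D \<noteq> {}"
    using degenerate_partition_if_not_feasible infeasible by (auto simp: D_def)
  ultimately have "Max (case_prod (weight s t) ` D) \<in> case_prod (weight s t) ` D"
    by (intro Max_in) auto
  then obtain p where p: "p \<in> D" and Max: "Max (case_prod (weight s t) ` D) = case_prod (weight s t) p"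
    by (elim imageE)
  have "case_prod (weight s t) q \<le> case_prod (weight s t) p" if "q \<in> D" for q
    unfolding Max[symmetric] using \<open>finite D\<close> that by (intro Max_ge) auto
  note p = p this
  obtain A B where part: "degenerate_partition s t A B"
    and max: "\<And>A' B'. degenerate_partition s t A' B' \<Longrightarrow> weight s t A' B' \<le> weight s t A B"
    using p by (cases p) (auto simp: D_def)
  have disj: "A \<inter> B = {}" and un: "A \<union> B = V" and dA: "degenerate s A" and dB: "degenerate t B"
    using part by (auto simp: degenerate_partition_def)
  obtain v where v: "v \<in> A" "\<not> degenerate t (insert v B)"
    using not_degenerate_insert_if_maximal[OF part max s_t_less V_nonempty] by blast
  have "\<exists>u\<in>B. \<not> degenerate s (insert u A)"
    using part max s_t_less V_nonempty
    by (intro not_degenerate_insert_if_maximal[of t s])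
      (simp_all add: degenerate_partition_swap[of t] weight_swap[of t] add.commute)
  then obtain u where u: "u \<in> B" "\<not> degenerate s (insert u A)" by blast
  obtain Y where Y: "Y \<subseteq> insert v B" "Y \<noteq> {}" "\<And>y. y \<in> Y \<Longrightarrow> t y < deg Y y"
    using v(2) unfolding degenerate_def not_le[symmetric] by blast
  obtain X where X: "X \<subseteq> insert u A" "X \<noteq> {}" "\<And>x. x \<in> X \<Longrightarrow> s x < deg X x"
    using u(2) unfolding degenerate_def not_le[symmetric] by blast
  have sub: "X \<subseteq> V" "Y \<subseteq> V" using X Y u v un by auto
  then have fin: "finite X" "finite Y" using finite_V finite_subset by auto
  have degs: "a x + w x \<le> deg X x" if "x \<in> X" for x
    using X(3)[OF that] by (simp add: s_def)
  have degs': "b y + w y \<le> deg Y y" if "y \<in> Y" for y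
    using Y(3)[OF that] by (simp add: t_def)
  \<comment> \<open>As \<open>A\<close> and \<open>B\<close> are disjoint, \<open>X\<close> and
    \<open>Y\<close> can share only \<open>u\<close> and \<open>v\<close>; \<open>u\<close> stays in
    \<open>X\<close> and \<open>v\<close> in \<open>Y\<close>.\<close>
  have "X - {v} \<noteq> {}"
    using X(2,3) by (intro minus_singleton_nonempty_if_deg) fastforce+
  moreover have "Y - {u} \<noteq> {}"
    using Y(2,3) by (intro minus_singleton_nonempty_if_deg) fastforce+
  moreover have "v \<in> V" "u \<in> V" using u v un by auto
  then have "good a (X - {v})" "good b (Y - {u})"
    using sub by (auto intro!: good_remove[where w = w] fin degs degs' m_le_w)
  moreover have "(X - {v}) \<inter> (Y - {u}) = {}" using X Y disj by blast
  ultimately have "feasible (X - {v}) (Y - {u})"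
    using sub unfolding feasible_def by blast
  with infeasible show False by blast
qed

text \<open>Take a feasible pair leaving the fewest vertices uncovered. If some remain,
  \<open>(A, V - A)\<close> is not feasible, so some \<open>v\<close> has degree below
  \<open>b v\<close> in \<open>V - A\<close>. It lies outside \<open>B\<close> and has enough degree
  into \<open>A\<close> to be added there, a contradiction.\<close>

lemma feasible_partition: "\<exists>A B. feasible A B \<and> A \<union> B = V"
proof -
  define N where "N k \<longleftrightarrow> (\<exists>A B. feasible A B \<and> card (V - (A \<union> B)) = k)" for k
  have "\<exists>k. N k" using feasible_pair by (auto simp: N_def)
  then obtain k where "N k" and least: "\<And>j. j < k \<Longrightarrow> \<not> N j"
    by (meson exists_least_iff)
  then obtain A B where AB: "feasible A B" and k: "card (V - (A \<union> B)) = k"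
    by (auto simp: N_def)
  have min: "\<not> feasible A' B'" if "A \<union> B \<subset> A' \<union> B'" for A' B'
  proof
    assume f: "feasible A' B'"
    then have "V - (A' \<union> B') \<subset> V - (A \<union> B)" using that unfolding feasible_def by blast
    then have "card (V - (A' \<union> B')) < k"
      using k finite_V psubset_card_mono by blast
    with least f show False by (auto simp: N_def)
  qed
  have ne: "A \<noteq> {}" "B \<noteq> {}" and disj: "A \<inter> B = {}" and sub: "A \<subseteq> V" "B \<subseteq> V"
    and gA: "good a A" and gB: "good b B"
    using AB by (auto simp: feasible_def)
  have fin: "finite A" using sub finite_V finite_subset by auto
  have "A \<union> B = V"
  proof (rule ccontr)
    assume neq: "A \<union> B \<noteq> V"
    have "\<not> feasible A (V - A)"
      using neq sub by (intro min) auto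
    then have "\<not> good b (V - A)"
      using ne disj sub gA unfolding feasible_def by blast
    then obtain v where v: "v \<in> V - A" "deg (V - A) v < b v" by (auto simp: good_def)
    have "v \<notin> B"
    proof
      assume "v \<in> B"
      moreover have "deg B v \<le> deg (V - A) v"
        using finite_V disj sub by (intro deg_mono) auto
      ultimately show False using gB v by (force simp: good_def)
    qed
    have "deg V v = deg A v + deg (V - A) v"
      using deg_Un[of A "V - A" v] fin finite_V sub by (simp add: Un_absorb1)
    \<comment> \<open>Fewer than \<open>b v\<close> of the at least
      \<open>a v + b v + 2 * w v - 1\<close> edges at \<open>v\<close> go to
      \<open>V - A\<close>.\<close>
    then have "a v \<le> deg A v" using deg_large[of v] v w_pos[of v] by auto
    then have "good a (insert v A)"
      using gA fin v by (auto simp: good_def deg_insert diag trans_le_add1)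
    then have "feasible (insert v A) B"
      using ne disj sub gB v \<open>v \<notin> B\<close> by (auto simp: feasible_def)
    moreover have "A \<union> B \<subset> insert v A \<union> B" using v \<open>v \<notin> B\<close> by blast
    ultimately show False using min by blast
  qed
  with AB show ?thesis by blast
qed

end

section \<open>Multigraphs as multiplicity functions\<close>

context multigraph
begin

lemma multiplicity_sym: "multiplicity G u v = multiplicity G v u"
  by (simp add: multiplicity_def insert_commute)

lemma multiplicity_diag: "multiplicity G v v = 0"
  using card_ends finite_edges by (force simp: multiplicity_def)

text \<open>The edges at \<open>v\<close> are classified by their other end; the class of
  \<open>x = v\<close> is empty since there are no loops.\<close>

lemma degree_induced_subgraph:
  assumes "X \<subseteq> verts G" "v \<in> X"
  shows "degree (induced_subgraph G X) v = (\<Sum>x\<in>X. multiplicity G v x)"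
proof -
  have "{e \<in> edges G. ends G e \<subseteq> X \<and> v \<in> ends G e} = (\<Union>x\<in>X. {e \<in> edges G. ends G e = {v, x}})"
    (is "?L = ?R")
  proof
    show "?L \<subseteq> ?R"
    proof
      fix e assume e: "e \<in> ?L"
      then have "card (ends G e) = 2" "v \<in> ends G e" using card_ends by auto
      then obtain x where "ends G e = {v, x}"
        by (metis card_2_iff insert_commute insertE singletonD)
      with e show "e \<in> ?R" by auto
    qed
    show "?R \<subseteq> ?L" using assms by auto
  qed
  moreover have "card ?R = (\<Sum>x\<in>X. multiplicity G v x)"
    unfolding multiplicity_def using assms finite_verts finite_edges
    by (intro card_UN_disjoint) (auto intro: finite_subset simp: doubleton_eq_iff)
  ultimately show ?thesis
    by (simp add: degree_def induced_subgraph_def conj_assoc)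
qed

lemma degree_eq_sum_multiplicity:
  assumes "v \<in> verts G"
  shows "degree G v = (\<Sum>x\<in>verts G. multiplicity G v x)"
proof -
  have "degree G v = degree (induced_subgraph G (verts G)) v"
    using ends_subset unfolding degree_def induced_subgraph_def
    by (intro arg_cong[where f = card]) auto
  with degree_induced_subgraph[OF subset_refl assms] show ?thesis by simp
qed

lemma multiplicity_le_max_multiplicity:
  assumes "u \<in> verts G"
  shows "multiplicity G v u \<le> max_multiplicity G v"
  using assms finite_verts multiplicity_diag
  \<comment> \<open>The maximum does not range over \<open>v\<close> itself, where the multiplicity
    is 0.\<close>
  by (cases "u = v") (auto simp: max_multiplicity_def)

text \<open>Otherwise all multiplicities at \<open>v\<close> vanish and \<open>v\<close> is
  isolated.\<close>

lemma max_multiplicity_pos: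
  assumes "min_degree G \<ge> 1" "v \<in> verts G"
  shows "1 \<le> max_multiplicity G v"
proof (rule ccontr)
  assume "\<not> ?thesis"
  then have "multiplicity G v x = 0" if "x \<in> verts G" for x
    using multiplicity_le_max_multiplicity[OF that, of v] by simp
  then have "degree G v = 0" using assms by (simp add: degree_eq_sum_multiplicity)
  moreover have "min_degree G \<le> degree G v"
    using assms finite_verts by (simp add: min_degree_def)
  ultimately show False using assms by simp
qed

end

theorem theorem1:
  fixes G :: "('v, 'e) mgraph" and a b :: "'v \<Rightarrow> nat"
  assumes "multigraph G"
    and "min_degree G \<ge> 1"
    and "\<And>v. v \<in> verts G \<Longrightarrow>
      int (degree G v) \<ge> int (a v) + int (b v) + 2 * int (max_multiplicity G v) - 1"
  shows "\<exists>A B. A \<noteq> {} \<and> B \<noteq> {} \<and> A \<inter> B = {} \<and> A \<union> B = verts G \<and>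
    (\<forall>v\<in>A. degree (induced_subgraph G A) v \<ge> a v) \<and>
    (\<forall>v\<in>B. degree (induced_subgraph G B) v \<ge> b v)"
proof -
  interpret multigraph G by fact
  interpret symmetric_weights "verts G" "multiplicity G"
    by unfold_locales (use finite_verts multiplicity_sym multiplicity_diag in auto)
  interpret stiebitz_weights "verts G" "multiplicity G" "max_multiplicity G" a b
  proof unfold_locales
    fix v assume v: "v \<in> verts G"
    show "a v + b v + 2 * max_multiplicity G v \<le> deg (verts G) v + 1"
      using assms(3)[OF v] unfolding deg_def degree_eq_sum_multiplicity[OF v, symmetric] by linarith
  qed (use verts_nonempty max_multiplicity_pos[OF assms(2)] multiplicity_le_max_multiplicity in auto)
  obtain A B where "feasible A B" "A \<union> B = verts G"
    using feasible_partition by blast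
  moreover from this have "A \<subseteq> verts G" "B \<subseteq> verts G" by auto
  ultimately show ?thesis
    unfolding feasible_def good_def deg_def
    by (intro exI[of _ A] exI[of _ B]) (auto simp: degree_induced_subgraph)
qed

end
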